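(* Let $X$ be a real Banach space and let $h : X\times X^*\to[-\infty,+\infty]$ be a convex function. Then $h$ satisfies $$h(x,x^* )\ge \langle x,x^*\rangle\quad \forall (x,x^* )\in X\times X^*\qquad\text{and}\qquad h^*(x^*,x^{**})\ge \langle x^*,x^{**}\rangle\quad \forall (x^*,x^{**})\in X^*\times X^{**}$$ if and only if $$\inf_{(x,x^* )\in X\times X^*}\Big( h_{(x_0,x_0^* )}(x,x^* )+\tfrac12\|x\|^2+\tfrac12\|x^*\|^2\Big)=0\qquad \text{for all } (x_0,x_0^* )\in X\times X^*.$$
   Context: $X^*$ and $X^{**}$ denote the topological dual and bidual of the real Banach space $X$ (not assumed reflexive), with their usual dual norms. The duality products are $\langle x,x^*\rangle=x^*(x)$ on $X\times X^*$ and $\langle x^*,x^{**}\rangle=x^{**}(x^* )$ on $X^*\times X^{**}$. An extended-real-valued function is convex if its epigraph is convex. For $h:X\times X^*\to[-\infty,+\infty]$, the conjugate is $h^*:X^*\times X^{**}\to[-\infty,+\infty]$ (identifying $(X\times X^* )^*$ with $X^*\times X^{**}$), $$h^*(x^*,x^{**})=\sup_{(y,y^* )\in X\times X^*}\ \langle y,x^*\rangle+\langle y^*,x^{**}\rangle-h(y,y^* ).$$ For $(x_0,x_0^* )\in X\times X^*$, the function $h_{(x_0,x_0^* )}:X\times X^*\to[-\infty,+\infty]$ is defined by $$h_{(x_0,x_0^* )}(x,x^* )=h(x+x_0,x^*+x_0^* )-\big[\langle x,x_0^*\rangle+\langle x_0,x^*\rangle+\langle x_0,x_0^*\rangle\big].$$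 *)

theory Defs
  imports "HOL-Analysis.Analysis"
begin

type_synonym 'a dual = "'a \<Rightarrow>\<^sub>L real"

type_synonym 'a bidual = "'a dual dual"

definition pairing :: "'a::real_normed_vector \<Rightarrow> 'a dual \<Rightarrow> real"
  where "pairing x f = blinfun_apply f x"

text \<open>The epigraph lives over real heights, as usual for extended-real-valued functions; the
  library's \<^term>\<open>epigraph\<close> and \<^term>\<open>convex_on\<close> only cover real-valued functions.\<close>

definition ereal_epigraph :: "('b \<Rightarrow> ereal) \<Rightarrow> ('b \<times> real) set"
  where "ereal_epigraph h = {(z, r). h z \<le> ereal r}"

definition ereal_convex :: "('b::real_vector \<Rightarrow> ereal) \<Rightarrow> bool"
  where "ereal_convex h \<longleftrightarrow> convex (ereal_epigraph h)"

text \<open>In the next two definitions a real number is combined with an extended real, so the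
  indeterminate form \<^term>\<open>\<infinity> - \<infinity>\<close> does not arise.\<close>

definition conjugate ::
    "('a::real_normed_vector \<times> 'a dual \<Rightarrow> ereal) \<Rightarrow> 'a dual \<times> 'a bidual \<Rightarrow> ereal"
  where "conjugate h = (\<lambda>(xs, xss).
    SUP (y, ys) \<in> UNIV. ereal (pairing y xs + pairing ys xss) - h (y, ys))"

definition translate ::
    "('a::real_normed_vector \<times> 'a dual \<Rightarrow> ereal) \<Rightarrow> 'a \<times> 'a dual \<Rightarrow> 'a \<times> 'a dual \<Rightarrow> ereal"
  where "translate h = (\<lambda>(x0, x0s) (x, xs).
    h (x + x0, xs + x0s) - ereal (pairing x x0s + pairing x0 xs + pairing x0 x0s))"

end

theory Submission
  imports Defs
begin

text \<open>
  If the two inequalities hold and the infimum were at least \<open>m > 0\<close>, the convex set epi \<open>h\<close> would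
  lie above the continuous concave function \<open>m - G\<close>, where \<open>G\<close> is the translated quadratic term.
  A continuous affine function in between (Hahn--Banach) is a point \<open>(- L1, - L2)\<close> of the dual
  at which \<open>conjugate h\<close> is too small: there it is below the pairing by at least \<open>m\<close>, since
  \<open>\<parallel>W1\<parallel>\<^sup>2 / 2 + \<parallel>W2\<parallel>\<^sup>2 / 2 + \<langle>W1, W2\<rangle> \<ge> 0\<close> and the function
  \<open>\<parallel>\<cdot>\<parallel>\<^sup>2 / 2\<close> is its own conjugate. Conversely, evaluating the infimum at the origin gives the
  first inequality; and a point \<open>(xs, xss)\<close> violating the second one bounds \<open>h\<close> below by an affine
  function, which makes a suitable translated infimum positive. Reflexivity is not needed there:
  only the \<open>X\<^sup>*\<close>-component of the translation has to be adapted to \<open>xss\<close>.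
\<close>

section \<open>Sublinear functionals and the Hahn--Banach theorem\<close>

definition sublinear :: "('a::real_vector \<Rightarrow> real) \<Rightarrow> bool"
  where "sublinear p \<longleftrightarrow> (\<forall>x y. p (x + y) \<le> p x + p y) \<and> (\<forall>c x. c > 0 \<longrightarrow> p (c *\<^sub>R x) = c * p x)"

lemma sublinear_zero:
  assumes "sublinear p"
  shows "p 0 = 0"
proof -
  have "p (2 *\<^sub>R 0) = 2 * p 0"
    using assms unfolding sublinear_def by (metis zero_less_numeral)
  then show ?thesis by simp
qed

lemma sublinear_minus:
  assumes "sublinear p"
  shows "- p (- x) \<le> p x"
proof -
  have "p (x + - x) \<le> p x + p (- x)"
    using assms unfolding sublinear_def by blast
  then show ?thesis
    using sublinear_zero[OF assms] by simp
qed

text \<open>Using the hypothesis with \<open>inverse c\<close> at the point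
  \<open>c *\<^sub>R x\<close> gives the reverse inequality, so the infima below need only one
  direction of homogeneity.\<close>

lemma sublinear_scale_le:
  fixes q :: "'a::real_vector \<Rightarrow> real"
  assumes "\<And>c x. c > 0 \<Longrightarrow> q (c *\<^sub>R x) \<le> c * q x" "c > 0"
  shows "q (c *\<^sub>R x) = c * q x"
proof (rule antisym)
  have "q (inverse c *\<^sub>R (c *\<^sub>R x)) \<le> inverse c * q (c *\<^sub>R x)"
    using assms by (intro assms(1)) simp
  then have "q x \<le> inverse c * q (c *\<^sub>R x)"
    using \<open>c > 0\<close> by simp
  then show "c * q x \<le> q (c *\<^sub>R x)"
    using \<open>c > 0\<close> by (simp add: field_simps)
qed (use assms in simp)

text \<open>Supplies the bounds of chains for Zorn's lemma. The infimum is finite because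
  \<open>- p (- x) \<le> q x\<close> for every member \<open>q\<close>, and subadditivity survives
  because the smaller of two members serves for both.\<close>

lemma sublinear_INF_chain:
  assumes "C \<noteq> {}" and sub: "\<And>q. q \<in> C \<Longrightarrow> sublinear q"
    and le: "\<And>q. q \<in> C \<Longrightarrow> q \<le> p"
    and chain: "\<And>q q'. q \<in> C \<Longrightarrow> q' \<in> C \<Longrightarrow> q \<le> q' \<or> q' \<le> q"
  shows "sublinear (\<lambda>x. INF q\<in>C. q x)" "\<And>q. q \<in> C \<Longrightarrow> (\<lambda>x. INF q\<in>C. q x) \<le> q"
proof -
  have bdd: "bdd_below ((\<lambda>q. q x) ` C)" for x
  proof (rule bdd_belowI2)
    fix q assume "q \<in> C"
    then show "- p (- x) \<le> q x"
      using sublinear_minus[OF sub, of q x] le_funD[OF le, of q "- x"] by simp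
  qed
  show low: "(\<lambda>x. INF q\<in>C. q x) \<le> q" if "q \<in> C" for q
    using cINF_lower[OF bdd that] by (simp add: le_fun_def)
  show "sublinear (\<lambda>x. INF q\<in>C. q x)"
    unfolding sublinear_def
  proof (intro conjI allI impI)
    fix x y
    have *: "(INF q\<in>C. q (x + y)) \<le> q x + q' y" if "q \<in> C" "q' \<in> C" for q q'
    proof -
      obtain q0 where "q0 \<in> C" "q0 \<le> q" "q0 \<le> q'"
        using chain \<open>q \<in> C\<close> \<open>q' \<in> C\<close> by blast
      have "(INF q\<in>C. q (x + y)) \<le> q0 (x + y)"
        by (rule cINF_lower[OF bdd \<open>q0 \<in> C\<close>])
      also have "\<dots> \<le> q0 x + q0 y"
        using sub[OF \<open>q0 \<in> C\<close>] by (simp add: sublinear_def)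
      also have "\<dots> \<le> q x + q' y"
        using le_funD[OF \<open>q0 \<le> q\<close>, of x] le_funD[OF \<open>q0 \<le> q'\<close>, of y] by simp
      finally show ?thesis .
    qed
    have "(INF q\<in>C. q (x + y)) - q' y \<le> (INF q\<in>C. q x)" if "q' \<in> C" for q'
      using *[OF _ that] by (intro cINF_greatest[OF \<open>C \<noteq> {}\<close>]) (simp add: algebra_simps)
    then have "(INF q\<in>C. q (x + y)) - (INF q\<in>C. q x) \<le> (INF q\<in>C. q y)"
      by (intro cINF_greatest[OF \<open>C \<noteq> {}\<close>]) (simp add: algebra_simps)
    then show "(INF q\<in>C. q (x + y)) \<le> (INF q\<in>C. q x) + (INF q\<in>C. q y)"
      by simp
  next
    fix c :: real and x assume "c > 0"
    then show "(INF q\<in>C. q (c *\<^sub>R x)) = c * (INF q\<in>C. q x)"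
    proof (rule sublinear_scale_le[rotated])
      fix c :: real and x assume "c > 0"
      have "(INF q\<in>C. q (c *\<^sub>R x)) / c \<le> (INF q\<in>C. q x)"
      proof (rule cINF_greatest[OF \<open>C \<noteq> {}\<close>])
        fix q assume "q \<in> C"
        have "(INF q\<in>C. q (c *\<^sub>R x)) \<le> q (c *\<^sub>R x)"
          by (rule cINF_lower[OF bdd \<open>q \<in> C\<close>])
        also have "\<dots> = c * q x"
          using sub[OF \<open>q \<in> C\<close>] \<open>c > 0\<close> by (simp add: sublinear_def)
        finally show "(INF q\<in>C. q (c *\<^sub>R x)) / c \<le> q x"
          using \<open>c > 0\<close> by (simp add: field_simps)
      qed
      then show "(INF q\<in>C. q (c *\<^sub>R x)) \<le> c * (INF q\<in>C. q x)"
        using \<open>c > 0\<close> by (simp add: field_simps)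
    qed
  qed
qed

text \<open>This gives additivity of a minimal sublinear functional \<open>q\<close>: minimality forces \<open>q' = q\<close>,
  and then the second claim reads \<open>q x + q y \<le> q (x + y)\<close>.\<close>

lemma sublinear_shift:
  fixes q :: "'a::real_vector \<Rightarrow> real" and y :: 'a
  assumes q: "sublinear q"
  defines "q' \<equiv> \<lambda>x. INF t\<in>{0..}. q (x + t *\<^sub>R y) - t * q y"
  shows "sublinear q'" "q' x \<le> q (x + y) - q y" "q' \<le> q"
proof -
  have scale: "q (c *\<^sub>R x) = c * q x" if "c \<ge> 0" for c x
    using that q sublinear_zero[OF q] by (cases "c = 0") (auto simp: sublinear_def)
  have tri: "q (x + y) \<le> q x + q y" for x y
    using q by (simp add: sublinear_def)
  have bdd: "bdd_below ((\<lambda>t. q (x + t *\<^sub>R y) - t * q y) ` {0..})" for x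
  proof (rule bdd_belowI2)
    fix t :: real assume "t \<in> {0..}"
    then show "- q (- x) \<le> q (x + t *\<^sub>R y) - t * q y"
      using tri[of "x + t *\<^sub>R y" "- x"] scale[of t y] by simp
  qed
  have low: "q' x \<le> q (x + t *\<^sub>R y) - t * q y" if "t \<ge> 0" for x t
    unfolding q'_def using that by (intro cINF_lower[OF bdd]) simp
  have great: "m \<le> q' x" if "\<And>t. t \<ge> 0 \<Longrightarrow> m \<le> q (x + t *\<^sub>R y) - t * q y" for x m
    unfolding q'_def using that by (intro cINF_greatest) auto
  show "q' x \<le> q (x + y) - q y"
    using low[of 1 x] by simp
  show "q' \<le> q"
    using low[of 0] by (simp add: le_fun_def)
  show "sublinear q'"
    unfolding sublinear_def
  proof (intro conjI allI impI)
    fix x z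
    have *: "q' (x + z) \<le> (q (x + s *\<^sub>R y) - s * q y) + (q (z + t *\<^sub>R y) - t * q y)"
      if "s \<ge> 0" "t \<ge> 0" for s t
      using low[of "s + t" "x + z"] tri[of "x + s *\<^sub>R y" "z + t *\<^sub>R y"] that
      by (simp add: algebra_simps)
    have "q' (x + z) - (q (z + t *\<^sub>R y) - t * q y) \<le> q' x" if "t \<ge> 0" for t
      using *[OF _ that] by (intro great) (simp add: algebra_simps)
    then have "q' (x + z) - q' x \<le> q' z"
      by (intro great) (simp add: algebra_simps)
    then show "q' (x + z) \<le> q' x + q' z"
      by simp
  next
    fix c :: real and x assume "c > 0"
    then show "q' (c *\<^sub>R x) = c * q' x"
    proof (rule sublinear_scale_le[rotated])
      fix c :: real and x assume "c > 0"
      have "q' (c *\<^sub>R x) / c \<le> q' x"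
      proof (rule great)
        fix t :: real assume "t \<ge> 0"
        have "q' (c *\<^sub>R x) \<le> q (c *\<^sub>R x + (c * t) *\<^sub>R y) - (c * t) * q y"
          using \<open>c > 0\<close> \<open>t \<ge> 0\<close> by (intro low) simp
        also have "\<dots> = c * (q (x + t *\<^sub>R y) - t * q y)"
          using scale[of c "x + t *\<^sub>R y"] \<open>c > 0\<close> by (simp add: algebra_simps)
        finally show "q' (c *\<^sub>R x) / c \<le> q (x + t *\<^sub>R y) - t * q y"
          using \<open>c > 0\<close> by (simp add: field_simps)
      qed
      then show "q' (c *\<^sub>R x) \<le> c * q' x"
        using \<open>c > 0\<close> by (simp add: field_simps)
    qed
  qed
qed

text \<open>A minimal sublinear functional below \<open>p\<close>, provided by Zorn's lemma, is
  additive and hence linear.\<close>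

theorem hahn_banach_sublinear:
  assumes p: "sublinear p"
  obtains f where "linear f" "\<And>x. f x \<le> p x"
proof -
  define A where "A = {q. sublinear q \<and> q \<le> p}"
  have "\<exists>q\<in>A. \<forall>q'\<in>A. q' \<le> q \<longrightarrow> q' = q"
  proof (rule predicate_Zorn)
    \<comment> \<open>The order is reversed, so that a maximal element is a minimal
      functional.\<close>
    show "partial_order_on A (relation_of (\<lambda>q q'. q' \<le> q) A)"
      by (rule partial_order_on_relation_ofI) auto
  next
    fix C assume C: "C \<in> Chains (relation_of (\<lambda>q q'. q' \<le> q) A)"
    then have "C \<subseteq> A"
      by (auto simp: Chains_def relation_of_def)
    show "\<exists>u\<in>A. \<forall>q\<in>C. u \<le> q"
    proof (cases "C = {}")
      case True
      then show ?thesis using p by (auto simp: A_def)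
    next
      case False
      have chain: "q \<le> q' \<or> q' \<le> q" if "q \<in> C" "q' \<in> C" for q q'
        using C that by (auto simp: Chains_def relation_of_def)
      have sub: "sublinear q" "q \<le> p" if "q \<in> C" for q
        using \<open>C \<subseteq> A\<close> that by (auto simp: A_def)
      note inf = sublinear_INF_chain[OF False sub chain]
      have "(\<lambda>x. INF q\<in>C. q x) \<le> p"
        using False inf(2) sub(2) order_trans by blast
      then show ?thesis
        using inf by (auto simp: A_def)
    qed
  qed
  then obtain q where "q \<in> A" and least: "\<And>q'. q' \<in> A \<Longrightarrow> q' \<le> q \<Longrightarrow> q' = q"
    by blast
  then have q: "sublinear q" "q \<le> p"
    by (auto simp: A_def)
  have min: "q' = q" if "sublinear q'" "q' \<le> q" for q'
    using least[of q'] that order_trans[OF that(2) q(2)] by (simp add: A_def)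
  have add: "q (x + y) = q x + q y" for x y
  proof (rule antisym)
    show "q (x + y) \<le> q x + q y"
      using q by (simp add: sublinear_def)
    show "q x + q y \<le> q (x + y)"
      using sublinear_shift(2)[OF q(1), of x y] fun_cong[OF min[OF sublinear_shift(1,3)[OF q(1), of y]], of x]
      by simp
  qed
  have neg: "q (- x) = - q x" for x
    using add[of x "- x"] sublinear_zero[OF q(1)] by simp
  have pos: "q (c *\<^sub>R x) = c * q x" if "c > 0" for c x
    using q(1) that by (simp add: sublinear_def)
  have "q (c *\<^sub>R x) = c * q x" for c x
    using pos[of c x] pos[of "- c" x] neg[of "c *\<^sub>R x"] sublinear_zero[OF q(1)]
    by (cases c "0::real" rule: linorder_cases) auto
  with add have "linear q"
    by (intro linearI) auto
  with q(2) show thesis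
    by (intro that) (auto simp: le_fun_def)
qed

text \<open>Rearranged, the conclusion is \<open>m + L y - g y \<le> r + L x\<close>: a constant
  between the two sides, minus \<open>L\<close>, is an affine function above \<open>m - g\<close>
  and below \<open>S\<close>. Continuity of \<open>L\<close> is a separate matter.\<close>

lemma convex_sandwich:
  fixes S :: "('e::real_vector \<times> real) set" and g :: "'e \<Rightarrow> real"
  assumes S: "convex S" "S \<noteq> {}" and g: "convex_on UNIV g"
    and m: "\<And>x r. (x, r) \<in> S \<Longrightarrow> m \<le> r + g x"
  obtains L where "linear L" "\<And>x r y. (x, r) \<in> S \<Longrightarrow> m + L (y - x) \<le> r + g y"
proof -
  \<comment> \<open>\<open>p\<close> is the directional derivative at 0 of \<open>u \<mapsto> inf (r + g (x + u)) - m\<close> when that vanishes at 0;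
    with \<open>l\<close> ranging over all positive numbers it is sublinear in any case.\<close>
  define F where "F = (\<lambda>u (l, x, r). l * (r + g (x + u /\<^sub>R l) - m))"
  define I where "I = {0::real<..} \<times> S"
  define p where "p u = (INF i\<in>I. F u i)" for u
  have "I \<noteq> {}"
    using S(2) by (auto simp: I_def)
  have key: "\<exists>k\<in>I. F (u + v) k \<le> F u i + F v j" if ij: "i \<in> I" "j \<in> I" for u v i j
  proof -
    obtain l x r n y s where eq: "i = (l, x, r)" "j = (n, y, s)"
      by (metis prod_cases3)
    with ij have pos: "l > 0" "n > 0" and mem: "(x, r) \<in> S" "(y, s) \<in> S"
      by (auto simp: I_def)
    \<comment> \<open>With these weights \<open>a / l = b / n = 1 / (l + n)\<close>, so the
      combination of the points shifted by \<open>u / l\<close> and \<open>v / n\<close> is shifted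
      by \<open>(u + v) / (l + n)\<close>.\<close>
    define a where "a = l / (l + n)"
    define b where "b = n / (l + n)"
    have ab: "a \<ge> 0" "b \<ge> 0" "a + b = 1" "(l + n) * a = l" "(l + n) * b = n"
      using pos by (auto simp: a_def b_def add_divide_distrib[symmetric])
    have "a *\<^sub>R (x, r) + b *\<^sub>R (y, s) \<in> S"
      using convexD[OF S(1) mem ab(1-3)] .
    then have kI: "(l + n, a *\<^sub>R x + b *\<^sub>R y, a * r + b * s) \<in> I"
      using pos by (simp add: I_def)
    have "a / l = inverse (l + n)" "b / n = inverse (l + n)"
      using pos by (simp_all add: a_def b_def inverse_eq_divide)
    then have "(a *\<^sub>R x + b *\<^sub>R y) + (u + v) /\<^sub>R (l + n) = a *\<^sub>R (x + u /\<^sub>R l) + b *\<^sub>R (y + v /\<^sub>R n)"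
      by (simp add: algebra_simps divide_inverse)
    then have "g ((a *\<^sub>R x + b *\<^sub>R y) + (u + v) /\<^sub>R (l + n)) \<le> a * g (x + u /\<^sub>R l) + b * g (y + v /\<^sub>R n)"
      using g ab(1-3) unfolding convex_on_def by simp
    then have "(a * r + b * s) + g ((a *\<^sub>R x + b *\<^sub>R y) + (u + v) /\<^sub>R (l + n)) - m
        \<le> a * (r + g (x + u /\<^sub>R l) - m) + b * (s + g (y + v /\<^sub>R n) - m)"
      using arg_cong[OF ab(3), of "\<lambda>t. t * m"] by (simp add: algebra_simps)
    then have "F (u + v) (l + n, a *\<^sub>R x + b *\<^sub>R y, a * r + b * s)
        \<le> (l + n) * (a * (r + g (x + u /\<^sub>R l) - m) + b * (s + g (y + v /\<^sub>R n) - m))"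
      unfolding F_def using pos by (simp add: mult_left_mono)
    also have "\<dots> = ((l + n) * a) * (r + g (x + u /\<^sub>R l) - m) + ((l + n) * b) * (s + g (y + v /\<^sub>R n) - m)"
      by (simp only: distrib_left mult.assoc)
    also have "\<dots> = F u i + F v j"
      by (simp only: ab F_def eq prod.case)
    finally show ?thesis
      using kI by blast
  qed
  have F0: "F 0 i \<ge> 0" if "i \<in> I" for i
    using that m by (auto simp: F_def I_def)
  have bdd: "bdd_below (F u ` I)" for u
  proof -
    obtain j where "j \<in> I"
      using \<open>I \<noteq> {}\<close> by blast
    show ?thesis
    proof (rule bdd_belowI2)
      fix i assume "i \<in> I"
      \<comment> \<open>For \<open>v = - u\<close> the left side of \<open>key\<close> is a value of
        \<open>F 0\<close>, hence nonnegative.\<close>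
      show "- F (- u) j \<le> F u i"
        using key[OF \<open>i \<in> I\<close> \<open>j \<in> I\<close>, of u "- u"] F0 by fastforce
    qed
  qed
  have low: "p u \<le> F u i" if "i \<in> I" for u i
    unfolding p_def using that by (rule cINF_lower[OF bdd])
  have great: "c \<le> p u" if "\<And>i. i \<in> I \<Longrightarrow> c \<le> F u i" for c u
    unfolding p_def using that by (intro cINF_greatest[OF \<open>I \<noteq> {}\<close>])
  have "sublinear p"
    unfolding sublinear_def
  proof (intro conjI allI impI)
    fix u v
    have *: "p (u + v) \<le> F u i + F v j" if "i \<in> I" "j \<in> I" for i j
      using key[OF that, of u v] low order_trans by blast
    have "p (u + v) - F v j \<le> p u" if "j \<in> I" for j
      using *[OF _ that] by (intro great) (simp add: algebra_simps)
    then have "p (u + v) - p u \<le> p v"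
      by (intro great) (simp add: algebra_simps)
    then show "p (u + v) \<le> p u + p v"
      by simp
  next
    fix c :: real and u assume "c > 0"
    then show "p (c *\<^sub>R u) = c * p u"
    proof (rule sublinear_scale_le[rotated])
      fix c :: real and u assume "c > 0"
      have "p (c *\<^sub>R u) / c \<le> p u"
      proof (rule great)
        fix i assume "i \<in> I"
        obtain l x r where i: "i = (l, x, r)"
          by (metis prod_cases3)
        \<comment> \<open>Scaling \<open>l\<close> together with \<open>u\<close> leaves the shift
          \<open>u / l\<close> unchanged.\<close>
        have "p (c *\<^sub>R u) \<le> F (c *\<^sub>R u) (c * l, x, r)"
          using \<open>i \<in> I\<close> \<open>c > 0\<close> by (intro low) (simp add: I_def i)
        also have "\<dots> = c * F u i"
          using \<open>c > 0\<close> by (simp add: F_def i mult.commute[of _ c] flip: mult.assoc)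
        finally show "p (c *\<^sub>R u) / c \<le> F u i"
          using \<open>c > 0\<close> by (simp add: field_simps)
      qed
      then show "p (c *\<^sub>R u) \<le> c * p u"
        using \<open>c > 0\<close> by (simp add: field_simps)
    qed
  qed
  then obtain L where L: "linear L" "\<And>u. L u \<le> p u"
    using hahn_banach_sublinear by blast
  show thesis
  proof (rule that[OF L(1)])
    fix x r y assume "(x, r) \<in> S"
    then have "L (y - x) \<le> F (y - x) (1, x, r)"
      using L(2)[of "y - x"] low[of "(1, x, r)" "y - x"] by (simp add: I_def)
    then show "m + L (y - x) \<le> r + g y"
      by (simp add: F_def)
  qed
qed

section \<open>Half squared norms and continuity of linear functionals\<close>

text \<open>Optimising the hypothesis along each line through 0 yields
  \<open>\<bar>f x\<bar> \<le> sqrt (2 * K) * norm x\<close>, which bounds the operator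
  norm.\<close>

lemma half_norm_power2_le:
  fixes f :: "'a::real_normed_vector dual"
  assumes "\<And>x. f x - (norm x)\<^sup>2 / 2 \<le> K"
  shows "(norm f)\<^sup>2 / 2 \<le> K"
proof -
  have "K \<ge> 0"
    using assms[of 0] by simp
  have "norm (f x) \<le> sqrt (2 * K) * norm x" for x
  proof (cases "x = 0")
    case False
    \<comment> \<open>The maximiser of \<open>t * f x - (t * norm x)\<^sup>2 / 2\<close> over real
      \<open>t\<close>.\<close>
    define c where "c = f x / (norm x)\<^sup>2"
    have c: "c * (norm x)\<^sup>2 = f x"
      using False by (simp add: c_def)
    have "(norm (c *\<^sub>R x))\<^sup>2 = c * (c * (norm x)\<^sup>2)"
      by (simp add: power_mult_distrib power2_eq_square)
    then have "c * f x \<le> 2 * K"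
      using assms[of "c *\<^sub>R x"] by (simp add: c blinfun.scaleR_right)
    then have "c * f x * (norm x)\<^sup>2 \<le> 2 * K * (norm x)\<^sup>2"
      by (intro mult_right_mono) auto
    also have "c * f x * (norm x)\<^sup>2 = (f x)\<^sup>2"
      using c by (simp add: power2_eq_square mult_ac)
    finally have "sqrt ((f x)\<^sup>2) \<le> sqrt (2 * K * (norm x)\<^sup>2)"
      by (rule real_sqrt_le_mono)
    then show ?thesis
      by (simp add: real_sqrt_mult)
  qed simp
  then have "norm f \<le> sqrt (2 * K)"
    using \<open>K \<ge> 0\<close> by (intro norm_blinfun_bound) auto
  then have "(norm f)\<^sup>2 \<le> (sqrt (2 * K))\<^sup>2"
    by (intro power_mono) auto
  then show ?thesis
    using \<open>K \<ge> 0\<close> by simp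
qed

text \<open>Fenchel--Young inequality: the product of the norms bounds the pairing and is dominated
  by the half squares.\<close>

lemma pairing_ge_neg_half_norms: "0 \<le> pairing x f + (norm x)\<^sup>2 / 2 + (norm f)\<^sup>2 / 2"
proof -
  have "\<bar>pairing x f\<bar> \<le> norm f * norm x"
    using norm_blinfun[of f x] by (simp add: pairing_def)
  moreover have "0 \<le> (norm f - norm x)\<^sup>2"
    by simp
  ultimately show ?thesis
    by (simp add: power2_diff)
qed

text \<open>Near \<open>x\<close> the function \<open>g\<close> is bounded, so \<open>L\<close> is
  bounded above on a ball about 0; scaling and the symmetry \<open>u \<mapsto> - u\<close> turn this
  into a norm bound.\<close>

lemma linear_bounded_above_imp_bounded_linear:
  fixes L :: "'e::real_normed_vector \<Rightarrow> real"
  assumes L: "linear L" and le: "\<And>y. L (y - x) \<le> g y" and cont: "isCont g x"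
  shows "bounded_linear L"
proof -
  obtain d where "d > 0" and d: "\<And>y. dist y x < d \<Longrightarrow> dist (g y) (g x) < 1"
    using cont unfolding continuous_at_eps_delta by (metis zero_less_one)
  define K where "K = g x + 1"
  have K: "L u \<le> K" if "norm u < d" for u
    using d[of "x + u"] le[of "x + u"] that by (simp add: dist_norm K_def)
  have bound: "L u \<le> norm u * (2 * K / d)" for u
  proof (cases "u = 0")
    case False
    define c where "c = d / (2 * norm u)"
    have "c > 0" "norm (c *\<^sub>R u) < d"
      using False \<open>d > 0\<close> by (auto simp: c_def)
    then have "c * L u \<le> K"
      using K[of "c *\<^sub>R u"] by (simp add: linear_scale[OF L])
    then show ?thesis
      using False \<open>d > 0\<close> by (simp add: c_def field_simps)
  qed (simp add: linear_0[OF L])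
  have "norm (L u) \<le> norm u * (2 * K / d)" for u
    using bound[of u] bound[of "- u"] by (simp add: linear_neg[OF L] abs_le_iff)
  then show ?thesis
    using L by (intro bounded_linear_intro[of L "2 * K / d"]) (auto simp: linear_add linear_scale)
qed

lemma half_norm_diff_power2_convex:
  fixes a :: "'a::real_normed_vector"
  assumes "u \<ge> 0" "v \<ge> 0" "u + v = 1"
  shows "(norm (u *\<^sub>R x + v *\<^sub>R y - a))\<^sup>2 / 2 \<le> u * ((norm (x - a))\<^sup>2 / 2) + v * ((norm (y - a))\<^sup>2 / 2)"
proof -
  have "u *\<^sub>R x + v *\<^sub>R y - a = u *\<^sub>R (x - a) + v *\<^sub>R (y - a)"
    using assms(3) by (simp add: algebra_simps flip: scaleR_add_left)
  then have "norm (u *\<^sub>R x + v *\<^sub>R y - a) \<le> u * norm (x - a) + v * norm (y - a)"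
    using norm_triangle_ineq[of "u *\<^sub>R (x - a)" "v *\<^sub>R (y - a)"] assms by simp
  then have "(norm (u *\<^sub>R x + v *\<^sub>R y - a))\<^sup>2 \<le> (u * norm (x - a) + v * norm (y - a))\<^sup>2"
    by (intro power_mono) auto
  also have "\<dots> \<le> u * (norm (x - a))\<^sup>2 + v * (norm (y - a))\<^sup>2"
    using convex_power2 assms unfolding convex_on_def by simp
  finally show ?thesis
    by simp
qed

section \<open>Upper bound for the translated infimum\<close>

lemma translate_bound_nonpos:
  fixes h :: "'a::real_normed_vector \<times> 'a dual \<Rightarrow> ereal"
  assumes conv: "ereal_convex h"
    and ge: "\<And>x xs. h (x, xs) \<ge> ereal (pairing x xs)"
    and conj: "\<And>xs xss. conjugate h (xs, xss) \<ge> ereal (pairing xs xss)"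
    and m: "\<And>x xs. ereal m \<le> translate h (x0, x0s) (x, xs) + ereal ((norm x)\<^sup>2 / 2 + (norm xs)\<^sup>2 / 2)"
  shows "m \<le> 0"
proof -
  define S where "S = ereal_epigraph h"
  \<comment> \<open>The translated expression without \<open>h\<close>, in the variable
    \<open>z = (x + x0, xs + x0s)\<close>.\<close>
  define G where "G = (\<lambda>z. (norm (fst z - x0))\<^sup>2 / 2 + (norm (snd z - x0s))\<^sup>2 / 2
    - (x0s (fst z) + snd z x0 - x0s x0))"
  have "convex S"
    using conv by (simp add: S_def ereal_convex_def)
  \<comment> \<open>The sandwich theorem needs a nonempty epigraph; otherwise the conjugate would be
    \<open>- \<infinity>\<close>, below the pairing.\<close>
  have "\<exists>z. h z \<noteq> \<infinity>"
  proof (rule ccontr)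
    assume "\<nexists>z. h z \<noteq> \<infinity>"
    then have "conjugate h (0, 0) = - \<infinity>"
      by (simp add: conjugate_def bot_ereal_def case_prod_unfold)
    then show False
      using conj[of 0 0] by simp
  qed
  then obtain z where z: "h z \<noteq> \<infinity>" ..
  obtain r where "h z \<le> ereal r"
    using z by (cases "h z") auto
  then have "(z, r) \<in> S"
    by (simp add: S_def ereal_epigraph_def)
  then have "S \<noteq> {}"
    by blast
  have G: "convex_on UNIV G"
    unfolding convex_on_def
  proof (intro conjI ballI allI impI)
    fix z w :: "'a \<times> 'a dual" and u v :: real
    assume uv: "u \<ge> 0" "v \<ge> 0" "u + v = 1"
    have A: "x0s (u *\<^sub>R fst z + v *\<^sub>R fst w) + (u *\<^sub>R snd z + v *\<^sub>R snd w) x0 - x0s x0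
        = u * (x0s (fst z) + snd z x0 - x0s x0) + v * (x0s (fst w) + snd w x0 - x0s x0)"
      using arg_cong[OF uv(3), of "\<lambda>t. t * x0s x0"] by (simp add: blinfun.bilinear_simps algebra_simps)
    show "G (u *\<^sub>R z + v *\<^sub>R w) \<le> u * G z + v * G w"
      using half_norm_diff_power2_convex[OF uv, of "fst z" "fst w" x0]
        half_norm_diff_power2_convex[OF uv, of "snd z" "snd w" x0s]
      unfolding G_def fst_add snd_add fst_scaleR snd_scaleR A distrib_left right_diff_distrib
      by linarith
  qed simp
  have "m \<le> r + G z" if "(z, r) \<in> S" for z r
  proof -
    have "h z \<le> ereal r"
      using that by (simp add: S_def ereal_epigraph_def)
    moreover have "ereal m \<le> h z + ereal (G z)"
      using m[of "fst z - x0" "snd z - x0s"]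
      by (cases "h z") (auto simp: translate_def G_def pairing_def blinfun.bilinear_simps algebra_simps)
    ultimately show ?thesis
      by (cases "h z") auto
  qed
  then obtain L where "linear L" and L: "\<And>z r y. (z, r) \<in> S \<Longrightarrow> m + L (y - z) \<le> r + G y"
    using convex_sandwich[OF \<open>convex S\<close> \<open>S \<noteq> {}\<close> G] by blast
  obtain z0 r0 where z0: "(z0, r0) \<in> S"
    using \<open>S \<noteq> {}\<close> by auto
  have "bounded_linear L"
  proof (rule linear_bounded_above_imp_bounded_linear[OF \<open>linear L\<close>])
    show "L (y - z0) \<le> r0 + G y - m" for y
      using L[OF z0, of y] by simp
    show "isCont (\<lambda>y. r0 + G y - m) z0"
      unfolding G_def by (intro continuous_intros) simp_all
  qed
  define L1 where "L1 = Blinfun (\<lambda>x. L (x, 0))"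
  define L2 where "L2 = Blinfun (\<lambda>xs. L (0, xs))"
  have L1: "L1 x = L (x, 0)" for x
    unfolding L1_def
    by (subst bounded_linear_Blinfun_apply)
      (intro bounded_linear_compose[OF \<open>bounded_linear L\<close>] bounded_linear_Pair bounded_linear_ident bounded_linear_zero, simp)
  have L2: "L2 xs = L (0, xs)" for xs
    unfolding L2_def
    by (subst bounded_linear_Blinfun_apply)
      (intro bounded_linear_compose[OF \<open>bounded_linear L\<close>] bounded_linear_Pair bounded_linear_ident bounded_linear_zero, simp)
  have L12: "L (x, xs) = L1 x + L2 xs" for x xs
    using linear_add[OF \<open>linear L\<close>, of "(x, 0)" "(0, xs)"] by (simp add: L1 L2)
  \<comment> \<open>At the point \<open>(x0, x0s) + (w1, w2)\<close> the terms of the sandwich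
    inequality linear in \<open>w1\<close> and \<open>w2\<close> are \<open>W1 w1 + W2 w2\<close>.
    The second summand of \<open>W2\<close> is \<open>x0\<close> seen in the bidual.\<close>
  define W1 where "W1 = L1 + x0s"
  define W2 where "W2 = L2 + Blinfun (\<lambda>f. blinfun_apply f x0)"
  have W2: "W2 f = L2 f + f x0" for f
    by (simp add: W2_def blinfun.add_left bounded_linear_Blinfun_apply blinfun.bounded_linear_left)
  define C where "C = - m - L (x0, x0s) - x0s x0 - (norm W1)\<^sup>2 / 2 - (norm W2)\<^sup>2 / 2"
  have dual: "- L z - r \<le> C" if "(z, r) \<in> S" for z r
  proof -
    define K where "K = r + L z - m - L (x0, x0s) - x0s x0"
    have "(W1 w1 - (norm w1)\<^sup>2 / 2) + (W2 w2 - (norm w2)\<^sup>2 / 2) \<le> K" for w1 w2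
    proof -
      have "L ((x0, x0s) + (w1, w2) - z) = L (x0, x0s) + L (w1, w2) - L z"
        by (simp only: linear_add[OF \<open>linear L\<close>] linear_diff[OF \<open>linear L\<close>])
      then show ?thesis
        using L[OF that, of "(x0, x0s) + (w1, w2)"]
        by (simp add: G_def K_def W1_def W2 L12 blinfun.bilinear_simps algebra_simps)
    qed
    \<comment> \<open>The variables separate: the supremum is taken over \<open>w1\<close> first,
      then over \<open>w2\<close>.\<close>
    then have "W1 w1 - (norm w1)\<^sup>2 / 2 \<le> K - (W2 w2 - (norm w2)\<^sup>2 / 2)" for w1 w2
      by (simp add: le_diff_eq)
    then have "(norm W1)\<^sup>2 / 2 \<le> K - (W2 w2 - (norm w2)\<^sup>2 / 2)" for w2
      by (rule half_norm_power2_le)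
    then have "W2 w2 - (norm w2)\<^sup>2 / 2 \<le> K - (norm W1)\<^sup>2 / 2" for w2
      by (simp add: algebra_simps)
    then have "(norm W2)\<^sup>2 / 2 \<le> K - (norm W1)\<^sup>2 / 2"
      by (rule half_norm_power2_le)
    then show ?thesis
      by (simp add: C_def K_def)
  qed
  have "conjugate h (- L1, - L2) \<le> ereal C"
    unfolding conjugate_def prod.case
  proof (rule SUP_least)
    fix z :: "'a \<times> 'a dual"
    obtain y ys where z: "z = (y, ys)"
      by (cases z)
    show "(case z of (y, ys) \<Rightarrow> ereal (pairing y (- L1) + pairing ys (- L2)) - h (y, ys)) \<le> ereal C"
    proof (cases "h (y, ys)")
      case (real r)
      then have "((y, ys), r) \<in> S"
        by (simp add: S_def ereal_epigraph_def)
      then show ?thesis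
        using dual real by (fastforce simp: z pairing_def L12 blinfun.bilinear_simps)
    next
      case PInf
      then show ?thesis by (simp add: z)
    next
      case MInf
      then show ?thesis using ge[of y ys] by simp
    qed
  qed
  then have "ereal (pairing (- L1) (- L2)) \<le> ereal C"
    using conj order_trans by blast
  then have "L2 L1 \<le> C"
    by (simp add: pairing_def blinfun.bilinear_simps)
  \<comment> \<open>By this identity \<open>L2 L1 \<le> C\<close> becomes \<open>W2 W1 + (norm
    W1)\<^sup>2 / 2 + (norm W2)\<^sup>2 / 2 \<le> - m\<close>, whose left side is
    nonnegative.\<close>
  moreover have "W2 W1 = L2 L1 + L (x0, x0s) + x0s x0"
    by (simp add: W2 W1_def L12 blinfun.bilinear_simps)
  ultimately show ?thesis
    using pairing_ge_neg_half_norms[of W1 W2] by (simp add: C_def pairing_def)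
qed

section \<open>From the infima to the conjugate inequality\<close>

text \<open>The infimum of \<open>b a + (norm a)\<^sup>2 / 2\<close> over \<open>a\<close> is
  \<open>- (norm b)\<^sup>2 / 2\<close>; it need not be attained, hence the slack
  \<open>\<delta>\<close>.\<close>

lemma exists_near_antidual:
  fixes b :: "'b::real_normed_vector dual"
  assumes "\<delta> > 0"
  obtains a where "b a + (norm a)\<^sup>2 / 2 + (norm b)\<^sup>2 / 2 < \<delta>"
proof -
  obtain a where "\<not> ((- b) a - (norm a)\<^sup>2 / 2 \<le> (norm b)\<^sup>2 / 2 - \<delta>)"
    using half_norm_power2_le[of "- b" "(norm b)\<^sup>2 / 2 - \<delta>"] assms by fastforce
  then show thesis
    by (intro that[of a]) (simp add: blinfun.bilinear_simps)
qed

text \<open>If the conjugate fell below the pairing at \<open>(xs, xss)\<close>, then translating by \<open>(0, xs - a)\<close>, where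
  \<open>\<parallel>a\<parallel> \<approx> \<parallel>xss\<parallel>\<close> and \<open>\<langle>a, xss\<rangle> \<approx> - \<parallel>xss\<parallel>\<^sup>2\<close>, would make the infimum positive.\<close>

lemma conjugate_ge_pairing:
  fixes h :: "'a::real_normed_vector \<times> 'a dual \<Rightarrow> ereal"
  assumes inf: "\<And>x0s. (INF (x, xs) \<in> UNIV.
      translate h (0, x0s) (x, xs) + ereal ((norm x)\<^sup>2 / 2 + (norm xs)\<^sup>2 / 2)) \<le> 0"
  shows "conjugate h (xs, xss) \<ge> ereal (pairing xs xss)"
proof (rule ccontr)
  assume "\<not> conjugate h (xs, xss) \<ge> ereal (pairing xs xss)"
  \<comment> \<open>The conjugate may be \<open>- \<infinity>\<close>; a real \<open>c\<close> in
    between allows real arithmetic.\<close>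
  then obtain c where c: "conjugate h (xs, xss) < ereal c" "c < pairing xs xss"
    by (metis ereal_dense2 ereal_less_eq(3) less_ereal.simps(1) not_le)
  obtain a where a: "xss a + (norm a)\<^sup>2 / 2 + (norm xss)\<^sup>2 / 2 < pairing xs xss - c"
    using exists_near_antidual[of "pairing xs xss - c" xss] c by auto
  define e where "e = pairing xs xss - c - (xss a + (norm a)\<^sup>2 / 2 + (norm xss)\<^sup>2 / 2)"
  have low: "ereal e \<le> translate h (0, xs - a) (x, ys) + ereal ((norm x)\<^sup>2 / 2 + (norm ys)\<^sup>2 / 2)" for x ys
  proof -
    let ?z = "(x, ys + (xs - a))"
    have "ereal (pairing x xs + pairing (ys + (xs - a)) xss) - h ?z \<le> conjugate h (xs, xss)"
      unfolding conjugate_def prod.case by (rule SUP_upper2[of ?z]) auto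
    then have *: "ereal (pairing x xs + pairing (ys + (xs - a)) xss) - h ?z \<le> ereal c"
      using c by simp
    show ?thesis
    proof (cases "h ?z")
      case (real r)
      \<comment> \<open>One Fenchel--Young inequality absorbs the norms of \<open>x\<close> and
        \<open>a\<close>, the other those of \<open>ys\<close> and \<open>xss\<close>; what is left
        is \<open>e\<close>, positive by the choice of \<open>a\<close>.\<close>
      then show ?thesis
        using * pairing_ge_neg_half_norms[of x a] pairing_ge_neg_half_norms[of ys xss]
        by (simp add: translate_def e_def pairing_def blinfun.bilinear_simps)
    qed (use * in \<open>auto simp: translate_def\<close>)
  qed
  have "ereal e \<le> (INF (x, ys) \<in> UNIV.
      translate h (0, xs - a) (x, ys) + ereal ((norm x)\<^sup>2 / 2 + (norm ys)\<^sup>2 / 2))"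
    using low by (intro INF_greatest) auto
  then have "ereal e \<le> 0"
    using inf order_trans by blast
  then show False
    using a by (simp add: e_def)
qed

section \<open>Pointwise inequalities and the equivalence\<close>

text \<open>The terms subtracted by \<open>translate\<close> turn the pairing at the shifted point
  into \<open>pairing x xs\<close>, to which the Fenchel--Young inequality applies.\<close>

lemma translate_add_half_norms_nonneg:
  fixes h :: "'a::real_normed_vector \<times> 'a dual \<Rightarrow> ereal"
  assumes "\<And>x xs. h (x, xs) \<ge> ereal (pairing x xs)"
  shows "0 \<le> translate h (x0, x0s) (x, xs) + ereal ((norm x)\<^sup>2 / 2 + (norm xs)\<^sup>2 / 2)"
  using assms[of "x + x0" "xs + x0s"] pairing_ge_neg_half_norms[of x xs]
  by (cases "h (x + x0, xs + x0s)") (auto simp: translate_def pairing_def blinfun.bilinear_simps)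

lemma pairing_le_if_translate_nonneg:
  fixes h :: "'a::real_normed_vector \<times> 'a dual \<Rightarrow> ereal"
  assumes "0 \<le> translate h (x, xs) (0, 0)"
  shows "h (x, xs) \<ge> ereal (pairing x xs)"
  using assms by (cases "h (x, xs)") (auto simp: translate_def pairing_def)

theorem theorem1p1:
  fixes h :: "'a::banach \<times> 'a dual \<Rightarrow> ereal"
  assumes "ereal_convex h"
  shows "((\<forall>x xs. h (x, xs) \<ge> ereal (pairing x xs)) \<and>
          (\<forall>xs xss. conjugate h (xs, xss) \<ge> ereal (pairing xs xss)))
     \<longleftrightarrow>
         (\<forall>x0 x0s. (INF (x, xs) \<in> UNIV.
            translate h (x0, x0s) (x, xs) + ereal ((norm x)\<^sup>2 / 2 + (norm xs)\<^sup>2 / 2)) = 0)"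
  (is "?L \<longleftrightarrow> (\<forall>x0 x0s. ?I x0 x0s = 0)")
proof
  assume L: ?L
  show "\<forall>x0 x0s. ?I x0 x0s = 0"
  proof (intro allI antisym)
    fix x0 x0s
    show "?I x0 x0s \<ge> 0"
      using L translate_add_half_norms_nonneg[of h] by (intro INF_greatest) auto
    show "?I x0 x0s \<le> 0"
    proof (rule ccontr)
      assume "\<not> ?I x0 x0s \<le> 0"
      \<comment> \<open>Density provides a real \<open>m\<close> even if the infimum is
        \<open>\<infinity>\<close>.\<close>
      then obtain m where m: "0 < ereal m" "ereal m < ?I x0 x0s"
        using ereal_dense2[of 0 "?I x0 x0s"] by (auto simp: not_le)
      have "ereal m \<le> translate h (x0, x0s) (x, xs) + ereal ((norm x)\<^sup>2 / 2 + (norm xs)\<^sup>2 / 2)" for x xs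
        using less_INF_D[OF m(2), of "(x, xs)"] by simp
      then have "m \<le> 0"
        using L by (intro translate_bound_nonpos[OF assms]) auto
      with m(1) show False
        by simp
    qed
  qed
next
  assume I: "\<forall>x0 x0s. ?I x0 x0s = 0"
  show ?L
  proof (intro conjI allI)
    fix x xs
    have "?I x xs \<le> translate h (x, xs) (0, 0)"
      by (rule INF_lower2[of "(0, 0)"]) (auto simp: zero_ereal_def[symmetric])
    then show "ereal (pairing x xs) \<le> h (x, xs)"
      using I by (intro pairing_le_if_translate_nonneg) simp
  next
    fix xs xss
    show "ereal (pairing xs xss) \<le> conjugate h (xs, xss)"
      using I by (intro conjugate_ge_pairing) simp
  qed
qed

end
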